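(* Let $(A,1_{lr})$ be a two-sided unital algebra, and let $$AC(A)=\{a\in Z(A)\mid Aa\subseteq N(A)\text{ and } Aa \text{ is a two-sided ideal of } A\}.$$ Then $$AC(A)=Z(A)\cap N(A)\cap Ann_A^l([A,A,A]_{\mathrm{as}}).$$
   Context: An algebra $A$ over a field $\mathbb{F}$ is a linear space with a bilinear product, written $x\cdot y$ or $xy$ (not assumed associative or commutative). It is two-sided unital if equipped with $1_{lr}\in A$ such that $1_{lr}\cdot x=x=x\cdot 1_{lr}$ for all $x\in A$. The associator is $[x,y,z]_{\mathrm{as}}=(xy)z-x(yz)$ and $[A,A,A]_{\mathrm{as}}=\{[x,y,z]_{\mathrm{as}}\mid x,y,z\in A\}$. The center is $Z(A)=\{a\in A\mid ax=xa\ \forall x\in A\}$ (commutation only). The nucleus is $N(A)=\{a\in A\mid [a,x,y]_{\mathrm{as}}=[x,a,y]_{\mathrm{as}}=[x,y,a]_{\mathrm{as}}=0\ \forall x,y\in A\}$. For $S\subseteq A$, $Ann_A^l(S)=\{a\in A\mid a\cdot s=0\ \forall s\in S\}$. $Aa=\{xa\mid x\in A\}$. *)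

theory Defs
  imports Main "HOL.Vector_Spaces"
begin

locale nonassoc_algebra = vector_space scale
  for scale :: "'f::field \<Rightarrow> 'a::ab_group_add \<Rightarrow> 'a" +
  fixes mult :: "'a \<Rightarrow> 'a \<Rightarrow> 'a"
  assumes linear_mult_left: "Vector_Spaces.linear scale scale (\<lambda>x. mult x y)"
    and linear_mult_right: "Vector_Spaces.linear scale scale (\<lambda>y. mult x y)"

locale unital_nonassoc_algebra = nonassoc_algebra scale mult
  for scale :: "'f::field \<Rightarrow> 'a::ab_group_add \<Rightarrow> 'a" and mult :: "'a \<Rightarrow> 'a \<Rightarrow> 'a" +
  fixes one :: 'a
  assumes mult_one_left: "mult one x = x"
    and mult_one_right: "mult x one = x"

definition associator ::
  "('a::ab_group_add \<Rightarrow> 'a \<Rightarrow> 'a) \<Rightarrow> 'a \<Rightarrow> 'a \<Rightarrow> 'a \<Rightarrow> 'a" where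
  "associator mult x y z = mult (mult x y) z - mult x (mult y z)"

text \<open>The set of values of the associator, not its linear span.\<close>

definition associators :: "('a::ab_group_add \<Rightarrow> 'a \<Rightarrow> 'a) \<Rightarrow> 'a set" where
  "associators mult = {associator mult x y z | x y z. True}"

text \<open>Elements of the center are only required to commute, not to associate, with all elements.\<close>

definition center :: "('a \<Rightarrow> 'a \<Rightarrow> 'a) \<Rightarrow> 'a set" where
  "center mult = {a. \<forall>x. mult a x = mult x a}"

definition nucleus :: "('a::ab_group_add \<Rightarrow> 'a \<Rightarrow> 'a) \<Rightarrow> 'a set" where
  "nucleus mult = {a. \<forall>x y. associator mult a x y = 0 \<and> associator mult x a y = 0
                            \<and> associator mult x y a = 0}"

definition left_annihilator :: "('a::zero \<Rightarrow> 'a \<Rightarrow> 'a) \<Rightarrow> 'a set \<Rightarrow> 'a set" where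
  "left_annihilator mult S = {a. \<forall>s\<in>S. mult a s = 0}"

definition left_multiples :: "('a \<Rightarrow> 'a \<Rightarrow> 'a) \<Rightarrow> 'a \<Rightarrow> 'a set" where
  "left_multiples mult a = {mult x a | x. True}"

definition two_sided_ideal ::
  "('f::field \<Rightarrow> 'a::ab_group_add \<Rightarrow> 'a) \<Rightarrow> ('a \<Rightarrow> 'a \<Rightarrow> 'a) \<Rightarrow> 'a set \<Rightarrow> bool" where
  "two_sided_ideal scale mult I \<longleftrightarrow>
     module.subspace scale I \<and> (\<forall>x. \<forall>i\<in>I. mult x i \<in> I \<and> mult i x \<in> I)"

definition AC ::
  "('f::field \<Rightarrow> 'a::ab_group_add \<Rightarrow> 'a) \<Rightarrow> ('a \<Rightarrow> 'a \<Rightarrow> 'a) \<Rightarrow> 'a set" where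
  "AC scale mult = {a \<in> center mult. left_multiples mult a \<subseteq> nucleus mult
                                   \<and> two_sided_ideal scale mult (left_multiples mult a)}"

end

theory Submission
  imports Defs
begin

text \<open>
  The idea: an element \<open>a\<close> of \<open>Z(A) \<inter> N(A)\<close> behaves like a scalar. It may be moved across
  products and re-bracketed freely, so it can be pulled out of every slot of an associator:
  \<open>[ax, y, z] = [x, ay, z] = [x, y, az] = a [x, y, z]\<close>
  (\<open>associator_pull_out\<close>). Hence the elements of \<open>Aa = aA\<close> are all nuclear exactly when \<open>a\<close>
  kills every associator (\<open>left_multiples_subset_nucleus_iff\<close>).

  The remaining conditions on both sides agree for cheap reasons. Since \<open>a = 1 a\<close> lies in \<open>Aa\<close>,
  the inclusion \<open>Aa \<subseteq> N(A)\<close> already forces \<open>a\<close> to be nuclear; conversely, for scalar-like \<open>a\<close>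
  the set \<open>Aa\<close> is always a two-sided ideal (\<open>two_sided_ideal_left_multiples\<close>), because
  \<open>x (y a) = (x y) a\<close> and \<open>(y a) x = (y x) a\<close>.
\<close>

lemma center_commute: "a \<in> center mult \<Longrightarrow> mult x a = mult a x"
  by (simp add: center_def)

lemma nucleus_assoc:
  assumes "a \<in> nucleus mult"
  shows "mult (mult a x) y = mult a (mult x y)"
    and "mult (mult x a) y = mult x (mult a y)"
    and "mult (mult x y) a = mult x (mult y a)"
  using assms by (simp_all add: nucleus_def associator_def)

context nonassoc_algebra
begin

lemma mult_diff_right: "mult x (y - z) = mult x y - mult x z"
  by (rule module_hom.diff[OF Vector_Spaces.linear.axioms(3)[OF linear_mult_right]])

lemma subspace_left_multiples: "subspace (left_multiples mult a)"
proof -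
  have "left_multiples mult a = (\<lambda>x. mult x a) ` UNIV"
    by (auto simp: left_multiples_def)
  moreover have "subspace ((\<lambda>x. mult x a) ` UNIV)"
    by (rule module_hom.subspace_image[OF Vector_Spaces.linear.axioms(3)[OF linear_mult_left] subspace_UNIV])
  ultimately show ?thesis by simp
qed

text \<open>
  In each slot, the two bracketings of the triple product are rewritten separately until \<open>a\<close>
  stands in front: \<open>a ((x y) z)\<close> and \<open>a (x (y z))\<close>. In the second and third slot, \<open>a\<close> passes \<open>x\<close>
  and \<open>y\<close> by alternating a commutation with a re-bracketing.
\<close>

lemma associator_pull_out:
  assumes "a \<in> center mult" and "a \<in> nucleus mult"
  shows "associator mult (mult a x) y z = mult a (associator mult x y z)"
    and "associator mult x (mult a y) z = mult a (associator mult x y z)"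
    and "associator mult x y (mult a z) = mult a (associator mult x y z)"
proof -
  have front: "mult (mult a u) v = mult a (mult u v)" for u v
    using assms(2) by (rule nucleus_assoc(1))
  have pass: "mult u (mult a v) = mult a (mult u v)" for u v
  proof -
    have "mult u (mult a v) = mult (mult u a) v"
      using assms(2) by (rule nucleus_assoc(2)[symmetric])
    also have "\<dots> = mult (mult a u) v"
      by (simp only: center_commute[OF assms(1)])
    finally show ?thesis by (simp only: front)
  qed
  show "associator mult (mult a x) y z = mult a (associator mult x y z)"
    by (simp only: associator_def mult_diff_right front)
  show "associator mult x (mult a y) z = mult a (associator mult x y z)"
    by (simp only: associator_def mult_diff_right front pass)
  show "associator mult x y (mult a z) = mult a (associator mult x y z)"
    by (simp only: associator_def mult_diff_right pass)
qed

lemma left_multiples_subset_nucleus_iff: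
  assumes "a \<in> center mult" and "a \<in> nucleus mult"
  shows "left_multiples mult a \<subseteq> nucleus mult \<longleftrightarrow>
    a \<in> left_annihilator mult (associators mult)"
proof -
  have "left_multiples mult a = {mult a x | x. True}"
    by (simp only: left_multiples_def center_commute[OF assms(1)])
  then have "left_multiples mult a \<subseteq> nucleus mult \<longleftrightarrow>
      (\<forall>x y z. associator mult (mult a x) y z = 0 \<and> associator mult y (mult a x) z = 0
        \<and> associator mult y z (mult a x) = 0)"
    by (auto simp: nucleus_def)
  also have "\<dots> \<longleftrightarrow> (\<forall>x y z. mult a (associator mult x y z) = 0)"
    unfolding associator_pull_out[OF assms] by blast
  also have "\<dots> \<longleftrightarrow> a \<in> left_annihilator mult (associators mult)"
    by (auto simp: left_annihilator_def associators_def)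
  finally show ?thesis .
qed

lemma two_sided_ideal_left_multiples:
  assumes "a \<in> center mult" and "a \<in> nucleus mult"
  shows "two_sided_ideal scale mult (left_multiples mult a)"
proof -
  have "mult x (mult y a) = mult (mult x y) a" for x y
    using assms(2) by (rule nucleus_assoc(3)[symmetric])
  moreover have "mult (mult y a) x = mult (mult y x) a" for x y
    by (simp only: nucleus_assoc(1)[OF assms(2)] center_commute[OF assms(1)])
  ultimately show ?thesis
    unfolding two_sided_ideal_def left_multiples_def
    using subspace_left_multiples[of a, unfolded left_multiples_def] by blast
qed

end

lemma (in unital_nonassoc_algebra) mem_left_multiples_self: "a \<in> left_multiples mult a"
  unfolding left_multiples_def using mult_one_left[of a, symmetric] by blast

theorem theorem24:
  fixes scale :: "'f::field \<Rightarrow> 'a::ab_group_add \<Rightarrow> 'a"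
    and mult :: "'a \<Rightarrow> 'a \<Rightarrow> 'a"
    and one :: 'a
  assumes "unital_nonassoc_algebra scale mult one"
  shows "AC scale mult =
    center mult \<inter> nucleus mult \<inter> left_annihilator mult (associators mult)"
proof -
  interpret unital_nonassoc_algebra scale mult one by (rule assms)
  have "a \<in> nucleus mult" if "left_multiples mult a \<subseteq> nucleus mult" for a
    using that mem_left_multiples_self by blast
  then show ?thesis
    unfolding AC_def
    using left_multiples_subset_nucleus_iff two_sided_ideal_left_multiples by blast
qed

end
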